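(* Let $G$ be a group of odd order. Then $f(G)=|G|-\max_{P}|P|$, where the maximum is taken over all proper twisted subgroups $P$ of $G$.
   Context: Twisted subgroup: a subset $P$ of a group $G$ is a twisted subgroup of $G$ if $P$ contains the identity and $aba\in P$ whenever $a,b\in P$. It is proper if $P\neq G$. Explorer-Director game on a finite group $G$: a token starts at some given element of $G$ (which counts as visited). The game is played in rounds, with no limit on the number of rounds. In each round, if the token is at $x$, Explorer picks an element $g\in G$, and then Director moves the token to either $xg$ or $xg^{-1}$, as Director chooses. Explorer wants to maximize, and Director to minimize, the number of distinct elements of $G$ ever visited by the token. $f(G)$ denotes the number of group elements visited assuming optimal play, i.e. the largest $k$ such that Explorer has a strategy guaranteeing that at least $k$ distinct elements are visited; by left translation it does not depend on the starting element. *)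

theory Defs
  imports "HOL-Algebra.Group" "HOL-Algebra.Coset"
begin

definition twisted_subgroup :: "('a, 'b) monoid_scheme \<Rightarrow> 'a set \<Rightarrow> bool" where
  "twisted_subgroup G P \<longleftrightarrow>
     P \<subseteq> carrier G \<and> \<one>\<^bsub>G\<^esub> \<in> P \<and> (\<forall>a\<in>P. \<forall>b\<in>P. a \<otimes>\<^bsub>G\<^esub> b \<otimes>\<^bsub>G\<^esub> a \<in> P)"

text \<open>A strategy of Explorer maps each finite history, i.e. the nonempty list of token positions
  up to and including the current one, to the group element picked next.  Explorer's earlier picks
  need not be recorded, as they are determined by the strategy and the positions.\<close>

definition explorer_strategy :: "('a, 'b) monoid_scheme \<Rightarrow> ('a list \<Rightarrow> 'a) \<Rightarrow> bool" where
  "explorer_strategy G \<sigma> \<longleftrightarrow> (\<forall>h. h \<noteq> [] \<and> set h \<subseteq> carrier G \<longrightarrow> \<sigma> h \<in> carrier G)"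

text \<open>The infinite position sequences \<open>p\<close> that can arise from the start \<open>x\<close>
  when Explorer follows \<open>\<sigma>\<close> and Director moves arbitrarily.\<close>

definition play :: "('a, 'b) monoid_scheme \<Rightarrow> 'a \<Rightarrow> ('a list \<Rightarrow> 'a) \<Rightarrow> (nat \<Rightarrow> 'a) \<Rightarrow> bool" where
  "play G x \<sigma> p \<longleftrightarrow>
     p 0 = x \<and>
     (\<forall>n. let g = \<sigma> (map p [0..<Suc n])
          in p (Suc n) = p n \<otimes>\<^bsub>G\<^esub> g \<or> p (Suc n) = p n \<otimes>\<^bsub>G\<^esub> inv\<^bsub>G\<^esub> g)"

definition explorer_guarantees :: "('a, 'b) monoid_scheme \<Rightarrow> 'a \<Rightarrow> nat \<Rightarrow> bool" where
  "explorer_guarantees G x k \<longleftrightarrow>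
     (\<exists>\<sigma>. explorer_strategy G \<sigma> \<and> (\<forall>p. play G x \<sigma> p \<longrightarrow> k \<le> card (range p)))"

text \<open>The value \<open>f(G)\<close> of the game, with the starting element \<open>x\<close> kept as a parameter.  For a
  finite group and \<open>x\<close> in its carrier, the guaranteed numbers contain \<open>0\<close> and are bounded by the
  order of the group, so the greatest one exists.\<close>

definition explorer_director_value :: "('a, 'b) monoid_scheme \<Rightarrow> 'a \<Rightarrow> nat" where
  "explorer_director_value G x = (GREATEST k. explorer_guarantees G x k)"

text \<open>The supremum in \<^typ>\<open>nat\<close> of a finite nonempty set is its maximum.  \<^const>\<open>Sup\<close> is used
  instead of \<^const>\<open>Max\<close> because the trivial group has no proper twisted subgroup, and the supremum
  of the empty set is \<open>0\<close> (whereas \<open>Max {}\<close> is unspecified).\<close>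

definition max_proper_twisted_subgroup_card :: "('a, 'b) monoid_scheme \<Rightarrow> nat" where
  "max_proper_twisted_subgroup_card G =
     Sup {card P | P. twisted_subgroup G P \<and> P \<noteq> carrier G}"

end

theory Submission
  imports Defs "HOL-Algebra.Multiplicative_Group"
begin

text \<open>Call \<open>U\<close> midpoint-closed if \<open>w g, w g\<inverse> \<in> U\<close> implies \<open>w \<in> U\<close>.  This says exactly that Director
  can keep the token outside \<open>U\<close> forever once it is outside.  In a group of odd order squaring is
  injective, so any two elements \<open>a, b\<close> have a unique midpoint, the solution \<open>w\<close> of
  \<open>b = w a\<inverse> w\<close>; counting then shows that the midpoint-closed sets containing the identity are the
  twisted subgroups.  Hence Director can save \<open>|P|\<close> elements by avoiding a translate of \<open>P\<close>.
  Conversely, the set of positions from which Explorer can force a visit to the unvisited set \<open>U\<close>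
  is midpoint-closed, so it is the whole group as long as \<open>|U|\<close> exceeds the maximal \<open>|P|\<close>.\<close>

definition midpoint_closed :: "('a, 'b) monoid_scheme \<Rightarrow> 'a set \<Rightarrow> bool" where
  "midpoint_closed G U \<longleftrightarrow>
     (\<forall>w\<in>carrier G. \<forall>g\<in>carrier G. w \<otimes>\<^bsub>G\<^esub> g \<in> U \<and> w \<otimes>\<^bsub>G\<^esub> inv\<^bsub>G\<^esub> g \<in> U \<longrightarrow> w \<in> U)"

section \<open>Midpoints and twisted subgroups in groups of odd order\<close>

context group
begin

text \<open>The power (|G| + 1)/2 undoes squaring, since z^(|G| + 1) = z.\<close>

lemma square_inj_on_odd_order:
  assumes "odd (order G)"
  shows "inj_on (\<lambda>z. z \<otimes> z) (carrier G)"
proof (rule inj_on_inverseI)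
  fix z assume z: "z \<in> carrier G"
  have "(z \<otimes> z) [^] (Suc (order G) div 2) = (z [^] (2::nat)) [^] (Suc (order G) div 2)"
    using z by (simp add: numeral_2_eq_2)
  also have "\<dots> = z [^] (2 * (Suc (order G) div 2))"
    using z by (simp add: nat_pow_pow)
  also have "2 * (Suc (order G) div 2) = Suc (order G)"
    using assms by simp
  also have "z [^] Suc (order G) = z"
    using z by (simp add: pow_order_eq_1)
  finally show "(z \<otimes> z) [^] (Suc (order G) div 2) = z" .
qed

text \<open>Left multiplication by \<open>inv a\<close> turns the map into the squaring of
  \<open>inv a \<otimes> w\<close>. Reading the image as \<open>a\<close> reflected in
  \<open>w\<close>, this is uniqueness of midpoints.\<close>

lemma reflection_inj_on:
  assumes "odd (order G)" and a: "a \<in> carrier G"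
  shows "inj_on (\<lambda>w. w \<otimes> inv a \<otimes> w) (carrier G)"
proof (rule inj_onI)
  fix v w assume v: "v \<in> carrier G" and w: "w \<in> carrier G"
    and eq: "v \<otimes> inv a \<otimes> v = w \<otimes> inv a \<otimes> w"
  have "(inv a \<otimes> v) \<otimes> (inv a \<otimes> v) = inv a \<otimes> (v \<otimes> inv a \<otimes> v)"
    using a v by (simp add: m_assoc)
  also have "\<dots> = (inv a \<otimes> w) \<otimes> (inv a \<otimes> w)"
    using a w eq by (simp add: m_assoc)
  finally have "inv a \<otimes> v = inv a \<otimes> w"
    by (rule inj_onD[OF square_inj_on_odd_order[OF assms(1)]]) (use a v w in auto)
  then show "v = w" using a v w by simp
qed

text \<open>Since a^(n+2) = a a^n a, induction in steps of two puts all powers of \<open>a\<close>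
  into \<open>P\<close>, and in a finite group the inverse is one of them.\<close>

lemma twisted_subgroup_inv_closed:
  assumes fin: "finite (carrier G)" and P: "twisted_subgroup G P" and a: "a \<in> P"
  shows "inv a \<in> P"
proof -
  have aG: "a \<in> carrier G" using P a by (auto simp: twisted_subgroup_def)
  have pow: "a [^] (n::nat) \<in> P" for n
  proof (induction n rule: induct_nat_012)
    case 0 then show ?case using P by (simp add: twisted_subgroup_def)
  next
    case 1 then show ?case using a aG by simp
  next
    case (ge2 n)
    have "a \<otimes> a [^] n \<otimes> a \<in> P" using P a ge2(1) by (simp add: twisted_subgroup_def)
    moreover have "a \<otimes> a [^] n \<otimes> a = a [^] Suc (Suc n)"
      using aG nat_pow_Suc2[OF aG, of n] by simp
    ultimately show ?case by simp
  qed
  have "order G > 0" using fin by (simp add: order_gt_0_iff_finite)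
  then have "a [^] (order G - 1) \<otimes> a = \<one>"
    using pow_order_eq_1[OF aG] nat_pow_Suc[of a "order G - 1"] by simp
  then have "inv a = a [^] (order G - 1)"
    using aG by (simp add: inv_equality)
  then show ?thesis using pow by simp
qed

lemma odd_order_finite_carrier: "odd (order G) \<Longrightarrow> finite (carrier G)"
  by (metis order_gt_0_iff_finite odd_pos)

text \<open>The reflection of \<open>w \<otimes> g\<close> in \<open>w\<close> is
  \<open>w \<otimes> inv g\<close>. The map \<open>?f\<close> sends \<open>P\<close> injectively
  into itself, hence onto itself by finiteness, so the unique preimage \<open>w\<close> of
  \<open>w \<otimes> inv g\<close> already lies in \<open>P\<close>.\<close>

lemma twisted_subgroup_imp_midpoint_closed:
  assumes odd: "odd (order G)" and P: "twisted_subgroup G P"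
  shows "midpoint_closed G P"
  unfolding midpoint_closed_def
proof (intro ballI impI, elim conjE)
  fix w g assume w: "w \<in> carrier G" and g: "g \<in> carrier G"
    and a: "w \<otimes> g \<in> P" and b: "w \<otimes> inv g \<in> P"
  let ?f = "\<lambda>v. v \<otimes> inv (w \<otimes> g) \<otimes> v"
  have fin: "finite (carrier G)" using odd by (rule odd_order_finite_carrier)
  have sub: "P \<subseteq> carrier G" using P by (simp add: twisted_subgroup_def)
  have inj: "inj_on ?f (carrier G)" using odd w g by (intro reflection_inj_on) auto
  have "inv (w \<otimes> g) \<in> P" using twisted_subgroup_inv_closed[OF fin P a] .
  then have "?f ` P \<subseteq> P" using P by (auto simp: twisted_subgroup_def)
  then have "?f ` P = P"
    using finite_subset[OF sub fin] inj_on_subset[OF inj sub] by (intro endo_inj_surj)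
  then obtain v where v: "v \<in> P" and "w \<otimes> inv g = ?f v" using b by blast
  moreover have "?f w = w \<otimes> inv g"
    using w g by (simp add: inv_mult_group m_assoc)
  ultimately have "w = v" using inj_onD[OF inj, of w v] w sub by auto
  then show "w \<in> P" using v by simp
qed

lemma midpoint_closed_imp_twisted_subgroup:
  assumes odd: "odd (order G)" and U: "midpoint_closed G U" "U \<subseteq> carrier G" "\<one> \<in> U"
  shows "twisted_subgroup G U"
proof -
  have fin: "finite (carrier G)" using odd by (rule odd_order_finite_carrier)
  then have finU: "finite U" using U(2) by (rule finite_subset[rotated])
  have reflect: "w \<otimes> inv a \<otimes> w \<in> U" if a: "a \<in> U" and w: "w \<in> U" for a w
  proof -
    let ?f = "\<lambda>v. v \<otimes> inv a \<otimes> v"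
    have aG: "a \<in> carrier G" using a U by auto
    have "?f ` carrier G = carrier G"
      using fin reflection_inj_on[OF odd aG] aG by (intro endo_inj_surj) auto
    have "U \<subseteq> ?f ` U"
    proof
      fix b assume b: "b \<in> U"
      then obtain v where v: "v \<in> carrier G" "b = ?f v"
        using \<open>?f ` carrier G = carrier G\<close> U(2) by blast
      \<comment> \<open>With the pick \<open>inv v \<otimes> a\<close>, the two moves from
        \<open>v\<close> lead to \<open>a\<close> and \<open>b\<close>, so \<open>v\<close> is their
        midpoint.\<close>
      have "v \<otimes> (inv v \<otimes> a) = a" using v aG by (simp flip: m_assoc)
      moreover have "v \<otimes> inv (inv v \<otimes> a) = b"
        using v aG by (simp add: inv_mult_group m_assoc)
      moreover have "inv v \<otimes> a \<in> carrier G" using v aG by simp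
      ultimately have "v \<in> U"
        using U(1) v(1) a b unfolding midpoint_closed_def by metis
      then show "b \<in> ?f ` U" using v(2) by blast
    qed
    then have "U = ?f ` U" using finU by (intro card_seteq card_image_le) auto
    then show ?thesis using w by blast
  qed
  \<comment> \<open>Reflection in the identity is inversion; reflecting \<open>inv b\<close> in
    \<open>a\<close> then gives \<open>a \<otimes> b \<otimes> a\<close>.\<close>
  have "inv a \<in> U" if "a \<in> U" for a
    using reflect[OF that U(3)] that U(2) by auto
  then have "a \<otimes> b \<otimes> a \<in> U" if "a \<in> U" "b \<in> U" for a b
    using reflect[of "inv b" a] that U(2) by auto
  then show ?thesis using U by (simp add: twisted_subgroup_def)
qed

section \<open>Left translates and the largest proper twisted subgroup\<close>

lemma mem_l_coset_iff:
  assumes "u \<in> carrier G" "U \<subseteq> carrier G" "w \<in> carrier G"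
  shows "w \<in> u <# U \<longleftrightarrow> inv u \<otimes> w \<in> U"
proof
  assume "w \<in> u <# U"
  then obtain v where "v \<in> U" "w = u \<otimes> v" by (auto simp: l_coset_def)
  moreover have "inv u \<otimes> (u \<otimes> v) = v"
    using assms \<open>v \<in> U\<close> by (auto simp flip: m_assoc)
  ultimately show "inv u \<otimes> w \<in> U" by simp
next
  assume "inv u \<otimes> w \<in> U"
  moreover have "w = u \<otimes> (inv u \<otimes> w)" using assms by (simp flip: m_assoc)
  ultimately show "w \<in> u <# U" by (auto simp: l_coset_def)
qed

text \<open>Moves are right multiplications, so they commute with left translation.\<close>

lemma midpoint_closed_l_coset:
  assumes "midpoint_closed G U" "U \<subseteq> carrier G" "u \<in> carrier G"
  shows "midpoint_closed G (u <# U)"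
  unfolding midpoint_closed_def
proof (intro ballI impI)
  fix w g assume w: "w \<in> carrier G" and g: "g \<in> carrier G"
    and "w \<otimes> g \<in> u <# U \<and> w \<otimes> inv g \<in> u <# U"
  then have "inv u \<otimes> w \<otimes> g \<in> U \<and> inv u \<otimes> w \<otimes> inv g \<in> U"
    using assms(2,3) by (simp add: mem_l_coset_iff m_assoc)
  then have "inv u \<otimes> w \<in> U"
    using assms(1,3) w g unfolding midpoint_closed_def by blast
  then show "w \<in> u <# U" using assms(2,3) w by (simp add: mem_l_coset_iff)
qed

lemma card_l_coset:
  assumes "u \<in> carrier G" "U \<subseteq> carrier G"
  shows "card (u <# U) = card U"
proof -
  have "u <# U = (\<lambda>v. u \<otimes> v) ` U" by (auto simp: l_coset_def)
  moreover have "inj_on (\<lambda>v. u \<otimes> v) U" using assms by (intro inj_onI) (simp add: subset_iff)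
  ultimately show ?thesis by (simp add: card_image)
qed

lemma card_twisted_subgroup_le_max:
  assumes "finite (carrier G)" "twisted_subgroup G P" "P \<noteq> carrier G"
  shows "card P \<le> max_proper_twisted_subgroup_card G"
  unfolding max_proper_twisted_subgroup_card_def
proof (rule cSup_upper)
  show "bdd_above {card P | P. twisted_subgroup G P \<and> P \<noteq> carrier G}"
    using assms(1) by (intro bdd_aboveI[of _ "order G"])
      (auto simp: twisted_subgroup_def order_def intro: card_mono)
qed (use assms in blast)

text \<open>Translating \<open>U\<close> by the inverse of one of its elements brings the identity
  into it. The translate is then a twisted subgroup too large to be proper.\<close>

lemma midpoint_closed_eq_carrier:
  assumes odd: "odd (order G)" and U: "midpoint_closed G U" "U \<subseteq> carrier G"
    and large: "card U > max_proper_twisted_subgroup_card G"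
  shows "U = carrier G"
proof -
  have fin: "finite (carrier G)" using odd by (rule odd_order_finite_carrier)
  obtain u where u: "u \<in> U" using large by fastforce
  then have uG: "u \<in> carrier G" using U by auto
  let ?P = "inv u <# U"
  have P: "twisted_subgroup G ?P"
  proof (rule midpoint_closed_imp_twisted_subgroup[OF odd])
    show "?P \<subseteq> carrier G" using uG U by (simp add: l_coset_subset_G)
    show "\<one> \<in> ?P" using u uG U by (simp add: mem_l_coset_iff)
  qed (use U uG in \<open>simp add: midpoint_closed_l_coset\<close>)
  have card: "card ?P = card U" using uG U by (simp add: card_l_coset)
  then have "?P = carrier G"
    using card_twisted_subgroup_le_max[OF fin P] large by force
  then show ?thesis using card fin U by (metis card_subset_eq)
qed

section \<open>Strategies of Director and Explorer\<close>

lemma explorer_guarantees_le_card: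
  assumes fin: "finite W" and W: "W \<subseteq> carrier G" "x \<in> W"
    and stay: "\<And>w g. w \<in> W \<Longrightarrow> g \<in> carrier G \<Longrightarrow> w \<otimes> g \<in> W \<or> w \<otimes> inv g \<in> W"
    and k: "explorer_guarantees G x k"
  shows "k \<le> card W"
proof -
  obtain \<sigma> where \<sigma>: "explorer_strategy G \<sigma>" "\<And>p. play G x \<sigma> p \<Longrightarrow> k \<le> card (range p)"
    using k by (auto simp: explorer_guarantees_def)
  \<comment> \<open>Director stays in \<open>W\<close>: if the first option leaves it,
    \<open>stay\<close> makes the second one safe.\<close>
  define move where "move h =
    (if last h \<otimes> \<sigma> h \<in> W then last h \<otimes> \<sigma> h else last h \<otimes> inv (\<sigma> h))" for h
  \<comment> \<open>Explorer's pick depends on the whole history, so the recursion runs over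
    histories and positions are read off as last entries.\<close>
  define hist where "hist n = rec_nat [x] (\<lambda>_ h. h @ [move h]) n" for n
  define p where "p n = last (hist n)" for n
  have hist_eq: "hist n = map p [0..<Suc n]" for n
    by (induction n) (simp_all add: hist_def p_def)
  have p_Suc: "p (Suc n) = move (hist n)" for n
    by (simp add: p_def hist_def)
  have in_W: "set (hist n) \<subseteq> W" for n
  proof (induction n)
    case 0 then show ?case using W by (simp add: hist_def)
  next
    case (Suc n)
    have ne: "hist n \<noteq> []" by (simp add: hist_eq)
    have "\<sigma> (hist n) \<in> carrier G"
      using \<sigma>(1) ne Suc W(1) by (auto simp: explorer_strategy_def)
    then have "move (hist n) \<in> W"
      using stay[of "last (hist n)" "\<sigma> (hist n)"] last_in_set[OF ne] Suc by (auto simp: move_def)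
    then show ?case using Suc by (simp add: hist_def)
  qed
  have "p 0 = x" by (simp add: p_def hist_def)
  moreover have "p (Suc n) = p n \<otimes> \<sigma> (hist n) \<or> p (Suc n) = p n \<otimes> inv (\<sigma> (hist n))" for n
    unfolding p_Suc by (simp add: move_def p_def)
  ultimately have "play G x \<sigma> p"
    unfolding play_def Let_def hist_eq[symmetric] by blast
  then have "k \<le> card (range p)" by (rule \<sigma>(2))
  also have "range p \<subseteq> W" using in_W by (auto simp: hist_eq)
  then have "card (range p) \<le> card W" using fin by (rule card_mono[rotated])
  finally show ?thesis .
qed

text \<open>The target is \<open>U\<close>. Let \<open>A n\<close> be the positions from which
  Explorer can force a visit to \<open>U\<close> within \<open>n\<close> rounds; the rank
  \<open>r\<close> is the first such \<open>n\<close>. The union of these levels is midpoint-closed,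
  so \<open>full\<close> gives every position a rank.\<close>

lemma forcing_rank_exists:
  assumes U: "U \<subseteq> carrier G"
    and full: "\<And>A. midpoint_closed G A \<Longrightarrow> U \<subseteq> A \<Longrightarrow> A \<subseteq> carrier G \<Longrightarrow> A = carrier G"
  shows "\<exists>r::'a \<Rightarrow> nat. \<forall>w\<in>carrier G - U. \<exists>g\<in>carrier G. r (w \<otimes> g) < r w \<and> r (w \<otimes> inv g) < r w"
proof -
  define A where "A = rec_nat U (\<lambda>_ B. B \<union>
    {w \<in> carrier G. \<exists>g\<in>carrier G. w \<otimes> g \<in> B \<and> w \<otimes> inv g \<in> B})"
  have A_0: "A 0 = U" and A_Suc: "\<And>n. A (Suc n) = A n \<union>
      {w \<in> carrier G. \<exists>g\<in>carrier G. w \<otimes> g \<in> A n \<and> w \<otimes> inv g \<in> A n}"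
    by (simp_all add: A_def)
  have mono: "A m \<subseteq> A n" if "m \<le> n" for m n
    using that by (rule lift_Suc_mono_le[of A, rotated]) (auto simp: A_Suc)
  have sub: "A n \<subseteq> carrier G" for n
    by (induction n) (use U in \<open>auto simp: A_0 A_Suc\<close>)
  \<comment> \<open>The levels increase, so both destinations lie in a common level and
    \<open>w\<close> enters at the next one.\<close>
  have "midpoint_closed G (\<Union>n. A n)"
    unfolding midpoint_closed_def
  proof (intro ballI impI)
    fix w g assume w: "w \<in> carrier G" and g: "g \<in> carrier G"
      and "w \<otimes> g \<in> (\<Union>n. A n) \<and> w \<otimes> inv g \<in> (\<Union>n. A n)"
    then obtain i j where "w \<otimes> g \<in> A i" "w \<otimes> inv g \<in> A j" by blast
    then have "w \<otimes> g \<in> A (max i j)" "w \<otimes> inv g \<in> A (max i j)"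
      using mono[of i "max i j"] mono[of j "max i j"] by auto
    then have "w \<in> A (Suc (max i j))" using w g by (auto simp: A_Suc)
    then show "w \<in> (\<Union>n. A n)" by blast
  qed
  then have all: "(\<Union>n. A n) = carrier G"
    using full[of "\<Union>n. A n"] sub A_0 by blast
  define r where "r w = (LEAST n. w \<in> A n)" for w
  have "\<exists>g\<in>carrier G. r (w \<otimes> g) < r w \<and> r (w \<otimes> inv g) < r w" if w: "w \<in> carrier G - U" for w
  proof -
    obtain m where "w \<in> A m" using w all by blast
    then have mem: "w \<in> A (r w)" unfolding r_def by (rule LeastI)
    \<comment> \<open>Level 0 is \<open>U\<close>, so the rank of \<open>w\<close> is positive;
      \<open>w\<close> is new at level \<open>Suc n\<close>, hence some pick sends both options into
      level \<open>n\<close>.\<close>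
    then obtain n where n: "r w = Suc n" using w by (cases "r w") (auto simp: A_0)
    have "w \<notin> A n" using n not_less_Least[of n "\<lambda>n. w \<in> A n"] unfolding r_def by linarith
    then obtain g where "g \<in> carrier G" "w \<otimes> g \<in> A n" "w \<otimes> inv g \<in> A n"
      using mem unfolding n A_Suc by blast
    moreover have "r v \<le> n" if "v \<in> A n" for v
      unfolding r_def using that by (rule Least_le)
    ultimately show ?thesis unfolding n less_Suc_eq_le by blast
  qed
  then show ?thesis by blast
qed

text \<open>Here \<open>V\<close> is the set visited so far, and Explorer always lowers the rank
  belonging to the current \<open>V\<close>. If fewer than \<open>k\<close> elements were ever
  visited, \<open>V\<close> would eventually stay constant and its rank would decrease
  forever.\<close>

lemma explorer_guarantees_if_forcing:
  assumes fin: "finite (carrier G)" and x: "x \<in> carrier G"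
    and force: "\<And>V. V \<subseteq> carrier G \<Longrightarrow> V \<noteq> {} \<Longrightarrow> card V < k \<Longrightarrow>
      \<exists>r::'a \<Rightarrow> nat. \<forall>w\<in>V. \<exists>g\<in>carrier G. r (w \<otimes> g) < r w \<and> r (w \<otimes> inv g) < r w"
  shows "explorer_guarantees G x k"
proof -
  obtain r :: "'a set \<Rightarrow> 'a \<Rightarrow> nat" where r:
    "\<And>V w. V \<subseteq> carrier G \<Longrightarrow> V \<noteq> {} \<Longrightarrow> card V < k \<Longrightarrow> w \<in> V \<Longrightarrow>
      \<exists>g\<in>carrier G. r V (w \<otimes> g) < r V w \<and> r V (w \<otimes> inv g) < r V w"
    using force by metis
  define good where "good V w g \<longleftrightarrow>
    g \<in> carrier G \<and> r V (w \<otimes> g) < r V w \<and> r V (w \<otimes> inv g) < r V w" for V w g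
  \<comment> \<open>The default \<open>\<one>\<close> keeps the pick legal for histories that admit
    no good element.\<close>
  define \<sigma> where "\<sigma> h = (if \<exists>g. good (set h) (last h) g
    then SOME g. good (set h) (last h) g else \<one>)" for h
  have good_\<sigma>: "good (set h) (last h) (\<sigma> h)" if "\<exists>g. good (set h) (last h) g" for h
    using someI_ex[OF that] that by (simp add: \<sigma>_def)
  have \<sigma>_carrier: "\<sigma> h \<in> carrier G" for h
  proof (cases "\<exists>g. good (set h) (last h) g")
    case True
    then show ?thesis using good_\<sigma> by (auto simp: good_def)
  qed (simp add: \<sigma>_def)
  have "k \<le> card (range p)" if p: "play G x \<sigma> p" for p
  proof (rule ccontr)
    assume "\<not> k \<le> card (range p)"
    then have small: "card (range p) < k" by simp
    have step: "p (Suc n) = p n \<otimes> \<sigma> (map p [0..<Suc n]) \<or>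
      p (Suc n) = p n \<otimes> inv (\<sigma> (map p [0..<Suc n]))" for n
      using p unfolding play_def Let_def by blast
    have p_carrier: "p n \<in> carrier G" for n
    proof (induction n)
      case 0 then show ?case using p x by (simp add: play_def)
    next
      case (Suc n)
      then show ?case using step[of n] \<sigma>_carrier[of "map p [0..<Suc n]"] by (metis inv_closed m_closed)
    qed
    then have sub: "range p \<subseteq> carrier G" by auto
    then have "finite (range p)" using fin by (rule finite_subset)
    \<comment> \<open>Finitely many times already exhaust the finite range, so from some
      \<open>N\<close> on the history contains every position of the play.\<close>
    then obtain C where C: "finite C" "range p = p ` C"
      using finite_subset_image[of "range p" p UNIV] by auto
    obtain N where N: "C \<subseteq> {..<N}" using C(1) by (meson finite_nat_iff_bounded)
    have visited: "set (map p [0..<Suc n]) = range p" if "n \<ge> N" for n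
    proof -
      have "C \<subseteq> set [0..<Suc n]" using N that by force
      then have "p ` C \<subseteq> p ` set [0..<Suc n]" by (rule image_mono)
      then show ?thesis using C(2) by auto
    qed
    have "r (range p) (p (Suc n)) < r (range p) (p n)" if "n \<ge> N" for n
    proof -
      have "good (range p) (p n) (\<sigma> (map p [0..<Suc n]))"
        using good_\<sigma>[of "map p [0..<Suc n]"] r[of "range p" "p n"] sub small
        unfolding visited[OF that] good_def by auto
      then show ?thesis using step[of n] by (auto simp: good_def)
    qed
    then have "\<exists>f. \<forall>i. (f (Suc i), f i) \<in> less_than"
      by (intro exI[of _ "\<lambda>i. r (range p) (p (N + i))"]) simp
    then show False
      using wf_less_than unfolding wf_iff_no_infinite_down_chain by (rule notE[rotated])
  qed
  then show ?thesis using \<sigma>_carrier by (auto simp: explorer_guarantees_def explorer_strategy_def)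
qed

end

section \<open>The value of the game\<close>

theorem corollary1p3:
  fixes G :: "('a, 'b) monoid_scheme" and x :: 'a
  assumes "group G" and "odd (order G)" and "x \<in> carrier G"
  shows "explorer_director_value G x = order G - max_proper_twisted_subgroup_card G"
  unfolding explorer_director_value_def
proof (rule Greatest_equality)
  interpret group G by fact
  let ?m = "max_proper_twisted_subgroup_card G"
  have fin: "finite (carrier G)" using assms(2) by (rule odd_order_finite_carrier)
  show "explorer_guarantees G x (order G - ?m)"
  proof (rule explorer_guarantees_if_forcing[OF fin assms(3)])
    fix V assume V: "V \<subseteq> carrier G" "card V < order G - ?m"
    \<comment> \<open>The unvisited set is the target; it is so large that only the whole group is a
      midpoint-closed set around it.\<close>
    have "card (carrier G - V) > ?m"
      using V fin by (simp add: card_Diff_subset finite_subset order_def)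
    then have "A = carrier G"
      if "midpoint_closed G A" "carrier G - V \<subseteq> A" "A \<subseteq> carrier G" for A
      using that card_mono[OF finite_subset[OF that(3) fin] that(2)]
      by (intro midpoint_closed_eq_carrier[OF assms(2)]) auto
    then have "\<exists>r::'a \<Rightarrow> nat. \<forall>w\<in>carrier G - (carrier G - V). \<exists>g\<in>carrier G.
        r (w \<otimes>\<^bsub>G\<^esub> g) < r w \<and> r (w \<otimes>\<^bsub>G\<^esub> inv\<^bsub>G\<^esub> g) < r w"
      by (intro forcing_rank_exists) auto
    then show "\<exists>r::'a \<Rightarrow> nat. \<forall>w\<in>V. \<exists>g\<in>carrier G.
        r (w \<otimes>\<^bsub>G\<^esub> g) < r w \<and> r (w \<otimes>\<^bsub>G\<^esub> inv\<^bsub>G\<^esub> g) < r w"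
      using V(1) by (simp add: double_diff)
  qed
  fix k assume k: "explorer_guarantees G x k"
  let ?S = "{card P | P. twisted_subgroup G P \<and> P \<noteq> carrier G}"
  show "k \<le> order G - ?m"
  proof (cases "?S = {}")
    \<comment> \<open>This is the trivial group: \<open>Sup {} = 0\<close>, and the whole carrier
      serves as Director's region.\<close>
    case True
    then have "?m = 0" unfolding max_proper_twisted_subgroup_card_def True by (simp add: Sup_nat_def)
    then show ?thesis
      using explorer_guarantees_le_card[OF fin _ assms(3) _ k] by (simp add: order_def)
  next
    case False
    have "finite ?S"
      using fin by (intro finite_subset[of ?S "card ` Pow (carrier G)"])
        (auto simp: twisted_subgroup_def)
    then have "Max ?S \<in> ?S" using False by (rule Max_in)
    moreover have "?m = Max ?S"
      using False unfolding max_proper_twisted_subgroup_card_def Sup_nat_def by (simp only: if_False)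
    ultimately obtain P where P: "twisted_subgroup G P" "P \<noteq> carrier G" "card P = ?m"
      unfolding mem_Collect_eq by metis
    then have sub: "P \<subseteq> carrier G" by (simp add: twisted_subgroup_def)
    then obtain y where y: "y \<in> carrier G" "y \<notin> P" using P(2) by blast
    \<comment> \<open>Chosen so that \<open>inv u\<close> carries \<open>x\<close> to
      \<open>y\<close>, which puts the start outside the translate of \<open>P\<close> by
      \<open>u\<close>.\<close>
    define u where "u = x \<otimes>\<^bsub>G\<^esub> inv\<^bsub>G\<^esub> y"
    have u: "u \<in> carrier G" using y assms(3) by (simp add: u_def)
    let ?U = "u <#\<^bsub>G\<^esub> P"
    have U: "?U \<subseteq> carrier G" using sub u by (simp add: l_coset_subset_G)
    have "inv\<^bsub>G\<^esub> u \<otimes>\<^bsub>G\<^esub> x = y"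
      using y assms(3) by (simp add: u_def inv_mult_group m_assoc)
    then have "x \<notin> ?U" using mem_l_coset_iff[OF u sub assms(3)] y by simp
    moreover have "midpoint_closed G ?U"
      using twisted_subgroup_imp_midpoint_closed[OF assms(2) P(1)] sub u
      by (rule midpoint_closed_l_coset)
    \<comment> \<open>Contrapositively, midpoint-closedness of \<open>?U\<close> says that from
      outside \<open>?U\<close> one of the two options stays outside.\<close>
    ultimately have "k \<le> card (carrier G - ?U)"
      using assms(3) unfolding midpoint_closed_def
      by (intro explorer_guarantees_le_card[OF _ _ _ _ k]) (use fin in blast)+
    also have "\<dots> = order G - ?m"
      using fin U P(3) card_l_coset[OF u sub]
      by (simp add: card_Diff_subset finite_subset order_def)
    finally show ?thesis .
  qed
qed

end
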